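(* For $L$ and $M$ being non-negative integers, we have \begin{equation*} \sum_{\substack{m\geq 0,\\ L\equiv m \text{ (mod 2)}}} q^{m^2}{3M \brack m}_{q^2} {2M + \frac{L-m}{2}\brack 2M}_{q^6} = \sum_{j=-\infty}^{\infty} q^{3j^2+2j}\, \mathcal{T}\left(L,M;\,j,j;\,q^6\right). \end{equation*}
   Context: Here $|q|<1$, $(a;q)_n=(1-a)(1-aq)\cdots(1-aq^{n-1})$, and the $q$-binomial coefficient ${m+n \brack m}_q = \frac{(q;q)_{m+n}}{(q;q)_m(q;q)_n}$ for $m,n\geq 0$ and $0$ otherwise. The refined $q$-trinomial coefficient (Warnaar) is \[\mathcal{T}(L,M;\,a,b;\,q) := \sum_{\substack{n\geq0, \\ L-a\equiv n \text{ (mod 2)}}} q^{\frac{n^2}{2}} {M\brack n}_q {M+b+\frac{L-a-n}{2} \brack M+b}_q {M-b +\frac{L+a-n}{2}\brack M-b}_q.\] *)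

theory Defs
  imports "HOL-Analysis.Infinite_Sum" "HOL-Number_Theory.Cong"
begin

definition qpochhammer :: "complex \<Rightarrow> complex \<Rightarrow> nat \<Rightarrow> complex" where
  "qpochhammer a q n = (\<Prod>k<n. 1 - a * q ^ k)"

text \<open>
  Upper and lower entry are integers, since negative ones occur in the definition of the
  refined trinomial coefficient below.  With \<open>m = k\<close> and \<open>n = N - k\<close>
  the condition \<open>m, n \<ge> 0\<close> becomes \<open>0 \<le> k \<le> N\<close>.
\<close>
definition qbinomial :: "int \<Rightarrow> int \<Rightarrow> complex \<Rightarrow> complex" where
  "qbinomial N k q =
    (if 0 \<le> k \<and> k \<le> N
     then qpochhammer q q (nat N) / (qpochhammer q q (nat k) * qpochhammer q q (nat (N - k)))
     else 0)"

text \<open>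
  The refined \<open>q\<close>-trinomial coefficient contains the half-integral powers
  \<open>q\<^bsup>n\<^sup>2/2\<^esup>\<close>, which depend on a choice of \<open>q\<^bsup>1/2\<^esup>\<close>.  The last argument
  \<open>r\<close> is that square root, so that \<open>\<T>(L,M;a,b;q)\<close> is
  \<open>refined_qtrinomial L M a b r\<close> with \<open>q = r\<^sup>2\<close>.  In particular
  \<open>\<T>(L,M;a,b;q\<^sup>6)\<close> is taken with \<open>r = q\<^sup>3\<close>, i.e. with
  \<open>(q\<^sup>6)\<^bsup>n\<^sup>2/2\<^esup> = q\<^bsup>3 n\<^sup>2\<^esup>\<close>; the principal root of \<open>q\<^sup>6\<close> could be
  \<open>-q\<^sup>3\<close> instead.  The congruence condition makes both divisions by 2 exact, and
  only finitely many summands are nonzero (those with \<open>n > M\<close> vanish).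
\<close>
definition refined_qtrinomial :: "int \<Rightarrow> int \<Rightarrow> int \<Rightarrow> int \<Rightarrow> complex \<Rightarrow> complex" where
  "refined_qtrinomial L M a b r =
    (\<Sum>\<^sub>\<infinity>n\<in>{n::nat. [L - a = int n] (mod 2)}.
       r ^ n\<^sup>2 * qbinomial M (int n) (r\<^sup>2)
       * qbinomial (M + b + (L - a - int n) div 2) (M + b) (r\<^sup>2)
       * qbinomial (M - b + (L + a - int n) div 2) (M - b) (r\<^sup>2))"

end

theory Submission
  imports Defs "HOL-Computational_Algebra.Formal_Power_Series"
begin

text \<open>
  Let $p = q^6$. As a generating function in $x^L$, the left side is
  $(-xq;q^2)_{3M}\, H(x)$ with $H(x) = \sum_k {2M+k \brack k}_p x^{2k}$, and splitting the product by residues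
  mod 3 gives $(-xq^3;p)_M (-xq;p)_M (-xq^5;p)_M H(x)$. The factor $(-xq^3;p)_M$ accounts for the sum over $n$
  in the refined trinomial. With $j = v - u$ and $L = n + u + v$, it remains to see that
  $(-xq;p)_M (-xq^5;p)_M H(x)$ has the coefficients
  $\sum_{u+v=s} q^{3(v-u)^2+2(v-u)} {M+v \brack u}_p {M+u \brack v}_p$. After expansion by the $q$-binomial
  theorem this is the $q$-Nanjundiah identity
  $\sum_k p^{(u-k)(v-k)} {M \brack u-k}{N \brack v-k}{M+N+k \brack k} = {M+v \brack u}{N+u \brack v}$
  at $N = M$, which follows from the $q$-Pascal rule by induction on $M$ and $u$.
\<close>

section \<open>q-binomial coefficients with natural entries\<close>

definition qbin :: "complex \<Rightarrow> nat \<Rightarrow> nat \<Rightarrow> complex" where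
  "qbin p n k = qbinomial (int n) (int k) p"

lemma qbin_eq:
  "qbin p n k = (if k \<le> n then qpochhammer p p n / (qpochhammer p p k * qpochhammer p p (n - k)) else 0)"
  by (simp add: qbin_def qbinomial_def nat_diff_distrib)

lemma qpochhammer_Suc: "qpochhammer p p (Suc n) = qpochhammer p p n * (1 - p ^ Suc n)"
  by (simp add: qpochhammer_def)

lemma qpochhammer_nonzero:
  assumes "norm p < 1"
  shows "qpochhammer p p n \<noteq> 0"
proof -
  have "1 - p * p ^ k \<noteq> 0" for k
  proof
    assume "1 - p * p ^ k = 0"
    then have "norm p ^ Suc k = 1"
      by (metis eq_iff_diff_eq_0 norm_one norm_power power_Suc)
    with assms show False
      by (metis norm_ge_zero power_less_one_iff less_irrefl zero_less_Suc)
  qed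
  then show ?thesis
    by (simp add: qpochhammer_def)
qed

lemma qbin_gt [simp]: "n < k \<Longrightarrow> qbin p n k = 0"
  by (simp add: qbin_eq)

lemma qbin_0 [simp]: "norm p < 1 \<Longrightarrow> qbin p n 0 = 1"
  using qpochhammer_nonzero[of p n] by (simp add: qbin_eq) (simp add: qpochhammer_def)

lemma qbin_self [simp]: "norm p < 1 \<Longrightarrow> qbin p n n = 1"
  using qpochhammer_nonzero[of p n] by (simp add: qbin_eq) (simp add: qpochhammer_def)

lemma qbin_symmetric: "k \<le> n \<Longrightarrow> qbin p n (n - k) = qbin p n k"
  by (simp add: qbin_eq mult.commute)

text \<open>With s = p^(k+1) and t = p^(n-k), clearing denominators leaves 1 - s t = (1 - t) + t (1
  - s). For n < k the exponent n - k truncates, but the coefficient beside it is 0.\<close>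

lemma qbin_Suc_Suc:
  assumes p: "norm p < 1"
  shows "qbin p (Suc n) (Suc k) = qbin p n (Suc k) + p ^ (n - k) * qbin p n k"
proof -
  consider "n < k" | "n = k" | d where "n = Suc (k + d)"
    using less_imp_Suc_add linorder_neqE_nat by blast
  then show ?thesis
  proof cases
    case 3
    define x y z where "x = qpochhammer p p k" and "y = qpochhammer p p d"
      and "z = qpochhammer p p (Suc (k + d))"
    have nz: "x \<noteq> 0" "y \<noteq> 0" "1 - p ^ Suc k \<noteq> 0" "1 - p ^ Suc d \<noteq> 0"
      using qpochhammer_nonzero[OF p, of "Suc k"] qpochhammer_nonzero[OF p, of "Suc d"]
      by (auto simp: x_def y_def qpochhammer_Suc)
    define s t where "s = p ^ Suc k" and "t = p ^ Suc d"
    have st: "p ^ Suc (Suc (k + d)) = s * t"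
      by (simp add: s_def t_def power_add)
    have "z * (1 - s * t) / ((x * (1 - s)) * (y * (1 - t)))
        = z / ((x * (1 - s)) * y) + t * (z / (x * (y * (1 - t))))"
      using nz unfolding s_def[symmetric] t_def[symmetric]
      by (simp add: divide_simps) (simp add: algebra_simps)
    moreover have "qbin p (Suc n) (Suc k) = z * (1 - s * t) / ((x * (1 - s)) * (y * (1 - t)))"
      unfolding 3 st[symmetric]
      by (simp add: qbin_eq qpochhammer_Suc[of p "Suc (k + d)"] qpochhammer_Suc[of p k]
            qpochhammer_Suc[of p d] Suc_diff_le x_def y_def z_def s_def t_def)
    moreover have "qbin p n (Suc k) = z / ((x * (1 - s)) * y)"
      unfolding 3 by (simp add: qbin_eq qpochhammer_Suc[of p k] x_def y_def z_def s_def)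
    moreover have "qbin p n k = z / (x * (y * (1 - t)))"
      unfolding 3
      by (simp add: qbin_eq qpochhammer_Suc[of p d] Suc_diff_le x_def y_def z_def t_def)
    moreover have "p ^ (n - k) = t"
      by (simp add: 3 t_def Suc_diff_le)
    ultimately show ?thesis by simp
  qed (use p in auto)
qed

section \<open>The q-Nanjundiah identity\<close>

definition qnanj_sum :: "complex \<Rightarrow> nat \<Rightarrow> nat \<Rightarrow> nat \<Rightarrow> nat \<Rightarrow> complex" where
  "qnanj_sum p M N u v = (\<Sum>k\<le>min u v.
     p ^ ((u - k) * (v - k)) * qbin p M (u - k) * qbin p N (v - k) * qbin p (M + N + k) k)"

text \<open>The q-Pascal rule is used twice. Applied to \<open>qbin p (Suc M + N + k) k\<close>, its
  extra term becomes, after shifting k by one, the sum at (u, v). Applied to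
  \<open>qbin p (Suc M) (Suc u - k)\<close>, it splits the rest into the sums at (Suc u, Suc v) and
  (u, Suc v). Each time the surplus power of p is independent of k and factors out.\<close>

lemma qnanj_sum_Suc:
  assumes p: "norm p < 1"
  shows "qnanj_sum p (Suc M) N (Suc u) (Suc v)
    = p ^ (M + N + 1) * qnanj_sum p (Suc M) N u v + qnanj_sum p M N (Suc u) (Suc v)
      + p ^ (M + Suc v - u) * qnanj_sum p M N u (Suc v)"
proof -
  let ?m = "min u v"
  let ?c = "\<lambda>k. p ^ ((Suc u - k) * (Suc v - k)) * qbin p N (Suc v - k)"
  have H: "qbin p (Suc M + N + k) k
      = qbin p (M + N + k) k + (if k = 0 then 0 else p ^ (M + N + 1) * qbin p (M + N + k) (k - 1))"
    for k
    using p qbin_Suc_Suc[OF p, of "M + N + k" "k - 1"] by (cases k) auto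
  have G: "qbin p (Suc M) (Suc u - k)
      = qbin p M (Suc u - k) + (if k \<le> u then p ^ (M - (u - k)) * qbin p M (u - k) else 0)"
    if "k \<le> Suc u" for k
    using p qbin_Suc_Suc[OF p, of M "u - k"] that by (cases "k = Suc u") (auto simp: Suc_diff_le)
  have "qnanj_sum p (Suc M) N (Suc u) (Suc v)
      = (\<Sum>k\<le>Suc ?m. ?c k * qbin p (Suc M) (Suc u - k) * qbin p (M + N + k) k)
      + (\<Sum>k\<le>Suc ?m. if k = 0 then 0 else
          ?c k * qbin p (Suc M) (Suc u - k) * (p ^ (M + N + 1) * qbin p (M + N + k) (k - 1)))"
    unfolding qnanj_sum_def H sum.distrib[symmetric] min_Suc_Suc
    by (intro sum.cong refl) (simp add: algebra_simps)
  also have "(\<Sum>k\<le>Suc ?m. if k = 0 then 0 else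
          ?c k * qbin p (Suc M) (Suc u - k) * (p ^ (M + N + 1) * qbin p (M + N + k) (k - 1)))
      = p ^ (M + N + 1) * qnanj_sum p (Suc M) N u v"
    unfolding qnanj_sum_def sum_distrib_left
    by (subst sum.atMost_Suc_shift) (simp add: mult_ac)
  also have "(\<Sum>k\<le>Suc ?m. ?c k * qbin p (Suc M) (Suc u - k) * qbin p (M + N + k) k)
      = (\<Sum>k\<le>Suc ?m. ?c k * qbin p M (Suc u - k) * qbin p (M + N + k) k)
      + (\<Sum>k\<le>Suc ?m. if k \<le> u then
          ?c k * (p ^ (M - (u - k)) * qbin p M (u - k)) * qbin p (M + N + k) k else 0)"
    unfolding sum.distrib[symmetric]
    by (intro sum.cong refl) (simp add: G algebra_simps)
  also have "(\<Sum>k\<le>Suc ?m. ?c k * qbin p M (Suc u - k) * qbin p (M + N + k) k)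
      = qnanj_sum p M N (Suc u) (Suc v)"
    unfolding qnanj_sum_def min_Suc_Suc by (intro sum.cong refl) (simp add: mult_ac)
  also have "(\<Sum>k\<le>Suc ?m. if k \<le> u then
          ?c k * (p ^ (M - (u - k)) * qbin p M (u - k)) * qbin p (M + N + k) k else 0)
      = (\<Sum>k\<le>min u (Suc v).
          ?c k * (p ^ (M - (u - k)) * qbin p M (u - k)) * qbin p (M + N + k) k)"
    by (intro sum.mono_neutral_cong_right) auto
  also have "\<dots> = p ^ (M + Suc v - u) * qnanj_sum p M N u (Suc v)"
    unfolding qnanj_sum_def sum_distrib_left
  proof (intro sum.cong refl)
    fix k assume k: "k \<in> {..min u (Suc v)}"
    show "?c k * (p ^ (M - (u - k)) * qbin p M (u - k)) * qbin p (M + N + k) k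
      = p ^ (M + Suc v - u) * (p ^ ((u - k) * (Suc v - k)) * qbin p M (u - k)
          * qbin p N (Suc v - k) * qbin p (M + N + k) k)"
    proof (cases "u - k \<le> M") \<comment> \<open>otherwise the exponents truncate, but both sides vanish\<close>
      case True
      have "(Suc u - k) * (Suc v - k) + (M - (u - k)) = (M + Suc v - u) + (u - k) * (Suc v - k)"
        using k True by (simp add: Suc_diff_le)
      then have "p ^ ((Suc u - k) * (Suc v - k)) * p ^ (M - (u - k))
          = p ^ (M + Suc v - u) * p ^ ((u - k) * (Suc v - k))"
        by (metis power_add)
      then show ?thesis by (simp add: mult_ac)
    qed simp
  qed
  finally show ?thesis by (simp add: add_ac)
qed

text \<open>Only k = u survives, since \<open>qbin p 0 (u - k)\<close> vanishes for k < u. If u > v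
  that index is out of range and both sides are 0.\<close>

lemma qnanj_sum_M0:
  assumes p: "norm p < 1"
  shows "qnanj_sum p 0 N u v = qbin p v u * qbin p (N + u) v"
proof (cases "u \<le> v")
  case True
  have "qnanj_sum p 0 N u v = (\<Sum>k\<in>{u}. qbin p N (v - k) * qbin p (N + k) k)"
    unfolding qnanj_sum_def using True p by (intro sum.mono_neutral_cong_right) auto
  also have "\<dots> = qbin p v u * qbin p (N + u) v"
    using True qpochhammer_nonzero[OF p] by (auto simp: qbin_eq divide_simps)
  finally show ?thesis .
next
  case False
  then show ?thesis by (auto simp: qnanj_sum_def intro!: sum.neutral)
qed

text \<open>Expanding both factors by q-Pascal shows that the product obeys the recurrence of
  \<open>qnanj_sum_Suc\<close>. That recurrence changes M with N fixed, so the two are kept apart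
  here, and it lowers u and v together, so v is generalised in the inner induction.\<close>

lemma q_nanjundiah:
  assumes p: "norm p < 1"
  shows "qnanj_sum p M N u v = qbin p (M + v) u * qbin p (N + u) v"
proof (induction M arbitrary: u v)
  case 0
  show ?case by (simp add: qnanj_sum_M0[OF p])
next
  case (Suc M)
  show ?case
  proof (induction u arbitrary: v)
    case 0
    show ?case by (simp add: qnanj_sum_def p)
  next
    case (Suc u)
    show ?case
    proof (cases v)
      case 0
      then show ?thesis by (simp add: qnanj_sum_def p)
    next
      case v: (Suc w)
      let ?a = "qbin p (M + Suc w) u" and ?b = "qbin p (N + u) (Suc w)" and ?c = "qbin p (N + u) w"
      have a: "qbin p (Suc M + Suc w) (Suc u) = qbin p (M + Suc w) (Suc u) + p ^ (M + Suc w - u) * ?a"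
        using qbin_Suc_Suc[OF p, of "M + Suc w" u] by simp
      have b: "qbin p (N + Suc u) (Suc w) = ?b + p ^ (N + u - w) * ?c"
        using qbin_Suc_Suc[OF p, of "N + u" w] by simp
      \<comment> \<open>The two q-Pascal exponents add up to M + N + 1. If one of the subtractions
        truncates, \<open>?a\<close> or \<open>?c\<close> is 0.\<close>
      have e: "p ^ (M + N + 1) * ?a * ?c = p ^ (M + Suc w - u) * ?a * (p ^ (N + u - w) * ?c)"
      proof (cases "u \<le> M + Suc w \<and> w \<le> N + u")
        case True
        then have *: "M + N + 1 = (M + Suc w - u) + (N + u - w)" by simp
        show ?thesis unfolding * power_add by (simp only: mult_ac)
      qed auto
      have "qnanj_sum p (Suc M) N (Suc u) (Suc w)
        = p ^ (M + N + 1) * ?a * ?c + qbin p (M + Suc w) (Suc u) * qbin p (N + Suc u) (Suc w)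
          + p ^ (M + Suc w - u) * ?a * ?b"
        unfolding qnanj_sum_Suc[OF p] Suc.IH \<open>\<And>v u. qnanj_sum p M N u v = _ u v\<close> by simp
      also have "\<dots> = qbin p (Suc M + Suc w) (Suc u) * qbin p (N + Suc u) (Suc w)"
        unfolding e a b by (simp add: algebra_simps)
      finally show ?thesis by (simp add: v)
    qed
  qed
qed

section \<open>Products (-cX; p)_n as power series\<close>

definition qbin_fps :: "complex \<Rightarrow> complex \<Rightarrow> nat \<Rightarrow> complex fps" where
  "qbin_fps c p n = (\<Prod>k<n. 1 + fps_const (c * p ^ k) * fps_X)"

text \<open>The q-binomial theorem: in the induction on n the new factor 1 + c p^n X reproduces the
  q-Pascal rule.\<close>

lemma qbin_fps_nth:
  assumes p: "norm p < 1"
  shows "fps_nth (qbin_fps c p n) k = p ^ (k choose 2) * c ^ k * qbin p n k"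
proof (induction n arbitrary: k)
  case 0
  then show ?case using p by (cases k) (auto simp: qbin_fps_def numeral_2_eq_2)
next
  case (Suc n)
  have S: "qbin_fps c p (Suc n) = qbin_fps c p n + fps_const (c * p ^ n) * qbin_fps c p n * fps_X"
    by (simp add: qbin_fps_def algebra_simps)
  show ?case
  proof (cases k)
    case 0
    then show ?thesis using p by (simp add: S Suc.IH numeral_2_eq_2)
  next
    case (Suc l)
    \<comment> \<open>The part p^l raises the exponent l choose 2 to Suc l choose 2, and p^(n-l) is
      the q-Pascal weight. For l > n both sides are 0.\<close>
    have *: "p ^ n * qbin p n l = p ^ l * p ^ (n - l) * qbin p n l"
      by (cases "l \<le> n") (simp_all add: power_add[symmetric])
    have c: "Suc l choose 2 = (l choose 2) + l"
      by (simp add: numeral_2_eq_2)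
    have "fps_nth (qbin_fps c p (Suc n)) k = p ^ (Suc l choose 2) * c ^ Suc l * qbin p n (Suc l)
        + c * (p ^ (l choose 2) * c ^ l) * (p ^ n * qbin p n l)"
      by (simp add: Suc S Suc.IH mult_ac)
    also have "\<dots> = p ^ (k choose 2) * c ^ k * qbin p (Suc n) k"
      unfolding * Suc qbin_Suc_Suc[OF p] c power_add by (simp add: algebra_simps)
    finally show ?thesis .
  qed
qed

text \<open>The factors with index 3M, 3M+1, 3M+2 have constants q, q^3, q^5 times (q^6)^M, one for
  each product on the right.\<close>

lemma qbin_fps_triple:
  "qbin_fps q (q\<^sup>2) (3 * M) = qbin_fps (q ^ 3) (q ^ 6) M * (qbin_fps q (q ^ 6) M * qbin_fps (q ^ 5) (q ^ 6) M)"
proof (induction M)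
  case (Suc M)
  have e: "(q\<^sup>2) ^ (3 * M) = (q ^ 6) ^ M" by (simp add: power_mult[symmetric])
  have "3 * Suc M = Suc (Suc (Suc (3 * M)))" by simp
  then have "qbin_fps q (q\<^sup>2) (3 * Suc M) = qbin_fps q (q\<^sup>2) (3 * M)
     * ((1 + fps_const (q * (q ^ 6) ^ M) * fps_X) * (1 + fps_const (q ^ 3 * (q ^ 6) ^ M) * fps_X)
       * (1 + fps_const (q ^ 5 * (q ^ 6) ^ M) * fps_X))"
    unfolding e[symmetric]
    by (simp add: qbin_fps_def mult_ac power2_eq_square eval_nat_numeral del: mult_Suc_right)
  then show ?case unfolding Suc.IH by (simp add: qbin_fps_def mult_ac)
qed (simp add: qbin_fps_def)

lemma int_choose_two: "2 * int (n choose 2) = int n ^ 2 - int n"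
  by (induction n) (auto simp: numeral_2_eq_2 algebra_simps)

text \<open>Rests on 2 (k choose 2) + k = k^2. It supplies the square exponents on both sides of the
  theorem: r = q on the left, r = q^3 in the trinomial.\<close>

lemma qbin_fps_square_nth:
  assumes "norm (r\<^sup>2) < 1"
  shows "fps_nth (qbin_fps r (r\<^sup>2) n) k = r ^ k\<^sup>2 * qbin (r\<^sup>2) n k"
proof -
  have "int (2 * (k choose 2) + k) = int (k\<^sup>2)"
    using int_choose_two[of k] by simp
  then have "2 * (k choose 2) + k = k\<^sup>2"
    by (simp only: of_nat_eq_iff)
  then show ?thesis
    by (simp add: qbin_fps_nth[OF assms] power_mult[symmetric] power_add[symmetric])
qed

section \<open>The left side as a coefficient of a power series\<close>

lemma qbinomial_neg: "x < 0 \<Longrightarrow> qbinomial (N + x) N p = 0"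
  by (simp add: qbinomial_def)

lemma qbinomial_nat_add: "qbinomial (int a + int k) (int a) p = qbin p (a + k) k"
  using qbin_symmetric[of k "a + k" p] by (simp add: qbin_def)

lemma infsum_finite_support:
  fixes f :: "'a \<Rightarrow> complex"
  assumes "finite B" "B \<subseteq> A" "\<And>x. x \<in> A - B \<Longrightarrow> f x = 0"
  shows "infsum f A = sum f B"
proof -
  have "infsum f A = infsum f B"
    using assms by (intro infsum_cong_neutral) auto
  then show ?thesis using assms by simp
qed

text \<open>The series H, which is the expansion of 1/(X^2; p)_(2M+1). Its zero odd coefficients
  encode the parity condition on m.\<close>

definition even_gf :: "complex \<Rightarrow> nat \<Rightarrow> complex fps" where
  "even_gf p M = Abs_fps (\<lambda>n. if even n then qbin p (2 * M + n div 2) (n div 2) else 0)"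

lemma lhs_eq_fps_nth:
  fixes L M :: nat and q :: complex
  assumes q: "norm q < 1"
  shows "(\<Sum>\<^sub>\<infinity>m\<in>{m::nat. [L = m] (mod 2)}.
            q ^ m\<^sup>2 * qbinomial (3 * int M) (int m) (q\<^sup>2)
            * qbinomial (2 * int M + (int L - int m) div 2) (2 * int M) (q ^ 6))
       = fps_nth (qbin_fps q (q\<^sup>2) (3 * M) * even_gf (q ^ 6) M) L" (is "infsum ?f ?S = _")
proof -
  have q2: "norm (q\<^sup>2) < 1"
    using q by (simp add: norm_power power_less_one_iff)
  have A: "fps_nth (qbin_fps q (q\<^sup>2) (3 * M)) m = q ^ m\<^sup>2 * qbinomial (3 * int M) (int m) (q\<^sup>2)" for m
    by (simp add: qbin_fps_square_nth[OF q2] qbin_def)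
  have "infsum ?f ?S = sum ?f {m \<in> ?S. m \<le> L}"
  proof (intro infsum_finite_support)
    fix m assume "m \<in> ?S - {m \<in> ?S. m \<le> L}"
    then have "(int L - int m) div 2 < 0" by auto
    from qbinomial_neg[OF this] show "?f m = 0" by simp
  qed auto
  \<comment> \<open>Indices of the wrong parity can be added, as they meet odd coefficients of
    \<open>even_gf\<close>; this completes the Cauchy product.\<close>
  also have "\<dots> = (\<Sum>m\<in>{0..L}. fps_nth (qbin_fps q (q\<^sup>2) (3 * M)) m * fps_nth (even_gf (q ^ 6) M) (L - m))"
  proof (intro sum.mono_neutral_cong_left ballI)
    fix m assume "m \<in> {0..L} - {m \<in> ?S. m \<le> L}"
    then have "odd (L - m)"
      by (auto simp: cong_def) presburger
    then show "fps_nth (qbin_fps q (q\<^sup>2) (3 * M)) m * fps_nth (even_gf (q ^ 6) M) (L - m) = 0"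
      by (simp add: even_gf_def)
  next
    fix m assume m: "m \<in> {m \<in> ?S. m \<le> L}"
    then have e: "even (L - m)"
      by (simp add: cong_def) presburger
    have "(int L - int m) div 2 = int ((L - m) div 2)"
      using m by (simp add: of_nat_diff zdiv_int)
    then have "qbinomial (2 * int M + (int L - int m) div 2) (2 * int M) (q ^ 6)
        = fps_nth (even_gf (q ^ 6) M) (L - m)"
      using e qbinomial_nat_add[of "2 * M" "(L - m) div 2" "q ^ 6"] by (simp add: even_gf_def)
    then show "?f m = fps_nth (qbin_fps q (q\<^sup>2) (3 * M)) m * fps_nth (even_gf (q ^ 6) M) (L - m)"
      by (simp add: A)
  qed auto
  finally show ?thesis by (simp add: fps_mult_nth)
qed

section \<open>Coefficients of the pair of products times H\<close>

lemma fps_nth_mult_even_gf: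
  "fps_nth (F * G * even_gf p M) s
    = (\<Sum>u\<le>s. \<Sum>k\<le>min u (s - u). fps_nth F (u - k) * fps_nth G (s - u - k) * qbin p (2 * M + k) k)"
proof -
  let ?g = "\<lambda>t i. fps_nth F i * fps_nth G (t - i) * fps_nth (even_gf p M) (s - t)"
  have "fps_nth (F * G * even_gf p M) s = (\<Sum>t\<in>{0..s}. \<Sum>i\<in>{0..t}. ?g t i)"
    by (simp add: fps_mult_nth sum_distrib_right)
  also have "\<dots> = (\<Sum>(t, i)\<in>(SIGMA t:{0..s}. {0..t}). ?g t i)"
    by (simp add: sum.Sigma)
  also have "\<dots> = (\<Sum>(t, i)\<in>{(t, i). i \<le> t \<and> t \<le> s \<and> even (s - t)}. ?g t i)"
    by (intro sum.mono_neutral_right) (auto simp: even_gf_def split: if_splits)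
  also have "\<dots> = (\<Sum>(u, k)\<in>(SIGMA u:{..s}. {..min u (s - u)}).
      fps_nth F (u - k) * fps_nth G (s - u - k) * qbin p (2 * M + k) k)"
  \<comment> \<open>Degrees i and t - i come from F and G, and s - t = 2k from
    \<open>even_gf\<close>. Sharing 2k equally, u = i + k and s - u = t - i + k, gives the index
    range of \<open>qnanj_sum\<close>.\<close>
  proof (rule sum.reindex_bij_witness[where i = "\<lambda>(u, k). (s - 2 * k, u - k)"
        and j = "\<lambda>(t, i). (i + (s - t) div 2, (s - t) div 2)"], goal_cases)
    case (5 a)
    obtain t i where a: "a = (t, i)" by fastforce
    with 5 obtain k where k: "i \<le> t" "t \<le> s" "s - t = 2 * k"
      by (auto simp del: even_diff_nat elim!: evenE)
    then have "s - (i + k) - k = t - i" by simp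
    with k a show ?case by (simp add: even_gf_def del: even_diff_nat)
  qed (auto simp del: even_diff_nat elim!: evenE)
  also have "\<dots> = (\<Sum>u\<le>s. \<Sum>k\<le>min u (s - u).
      fps_nth F (u - k) * fps_nth G (s - u - k) * qbin p (2 * M + k) k)"
    by (simp add: sum.Sigma)
  finally show ?thesis .
qed

text \<open>Lets the \<open>powi\<close> of the theorem be read as a natural power, so that
  exponents can be compared even at q = 0.\<close>

lemma three_square_add_nonneg: "0 \<le> 3 * d\<^sup>2 + 2 * (d::int)"
proof (cases "d \<ge> 0")
  case False
  then have "0 \<le> (- d) * (- 3 * d - 2)" by (intro mult_nonneg_nonneg) auto
  then show ?thesis by (simp add: power2_eq_square algebra_simps)
qed simp

text \<open>The exponents are 3i^2 - 2i and 3j^2 + 2j, with sum 3(j-i)^2 + 2(j-i) + 6ij. This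
  separates a weight in j - i from the weight of the q-Nanjundiah sum.\<close>

lemma q_exponent:
  fixes q :: complex
  shows "(q ^ 6) ^ (i choose 2) * q ^ i * ((q ^ 6) ^ (j choose 2) * (q ^ 5) ^ j)
    = q powi (3 * (int j - int i)\<^sup>2 + 2 * (int j - int i)) * (q ^ 6) ^ (i * j)"
proof -
  define e where "e = 3 * (int j - int i)\<^sup>2 + 2 * (int j - int i)"
  have e: "0 \<le> e" unfolding e_def by (rule three_square_add_nonneg)
  have "int (6 * (i choose 2) + i + (6 * (j choose 2) + 5 * j)) = int (nat e + 6 * (i * j))"
    using e int_choose_two[of i] int_choose_two[of j]
    by (simp add: e_def power2_eq_square algebra_simps)
  then have "6 * (i choose 2) + i + (6 * (j choose 2) + 5 * j) = nat e + 6 * (i * j)"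
    by (simp only: of_nat_eq_iff)
  then have "q ^ (6 * (i choose 2) + i + (6 * (j choose 2) + 5 * j)) = q powi e * (q ^ 6) ^ (i * j)"
    using e by (simp add: power_int_def power_add power_mult)
  then show ?thesis by (simp add: e_def power_add power_mult)
qed

lemma fps_nth_pair:
  assumes q: "norm q < 1"
  shows "fps_nth (qbin_fps q (q ^ 6) M * qbin_fps (q ^ 5) (q ^ 6) M * even_gf (q ^ 6) M) s
    = (\<Sum>u\<le>s. q powi (3 * (int (s - u) - int u)\<^sup>2 + 2 * (int (s - u) - int u))
        * (qbin (q ^ 6) (M + (s - u)) u * qbin (q ^ 6) (M + u) (s - u)))"
proof -
  have p: "norm (q ^ 6) < 1"
    using q by (simp add: norm_power power_less_one_iff)
  show ?thesis
    unfolding fps_nth_mult_even_gf q_nanjundiah[OF p, symmetric] qnanj_sum_def sum_distrib_left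
  proof (intro sum.cong refl)
    fix u k assume k: "k \<in> {..min u (s - u)}"
    define v where "v = s - u"
    \<comment> \<open>The difference is independent of k, so the \<open>powi\<close> factor leaves
      the sum over k.\<close>
    have d: "int (v - k) - int (u - k) = int v - int u"
      using k by (auto simp: v_def)
    have "fps_nth (qbin_fps q (q ^ 6) M) (u - k) * fps_nth (qbin_fps (q ^ 5) (q ^ 6) M) (v - k)
      = ((q ^ 6) ^ ((u - k) choose 2) * q ^ (u - k) * ((q ^ 6) ^ ((v - k) choose 2) * (q ^ 5) ^ (v - k)))
        * (qbin (q ^ 6) M (u - k) * qbin (q ^ 6) M (v - k))"
      unfolding qbin_fps_nth[OF p] by (simp only: mult_ac)
    then show "fps_nth (qbin_fps q (q ^ 6) M) (u - k) * fps_nth (qbin_fps (q ^ 5) (q ^ 6) M) (s - u - k)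
         * qbin (q ^ 6) (2 * M + k) k
      = q powi (3 * (int (s - u) - int u)\<^sup>2 + 2 * (int (s - u) - int u))
        * ((q ^ 6) ^ ((u - k) * (s - u - k)) * qbin (q ^ 6) M (u - k) * qbin (q ^ 6) M (s - u - k)
           * qbin (q ^ 6) (M + M + k) k)"
      unfolding q_exponent d v_def[symmetric] by (simp only: mult_2[of M, symmetric] mult_ac)
  qed
qed

section \<open>The right side as a coefficient of a power series\<close>

lemma rhs_eq_fps_nth:
  fixes L M :: nat and q :: complex
  assumes q: "norm q < 1"
  shows "(\<Sum>\<^sub>\<infinity>j\<in>(UNIV :: int set).
            q powi (3 * j\<^sup>2 + 2 * j) * refined_qtrinomial (int L) (int M) j j (q ^ 3))
       = fps_nth (qbin_fps (q ^ 3) (q ^ 6) M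
           * (qbin_fps q (q ^ 6) M * qbin_fps (q ^ 5) (q ^ 6) M * even_gf (q ^ 6) M)) L"
proof -
  define p where "p = q ^ 6"
  have p: "norm p < 1"
    using q by (simp add: p_def norm_power power_less_one_iff)
  have r: "(q ^ 3)\<^sup>2 = p" by (simp add: p_def power_mult[symmetric])
  define t where "t j n = (q ^ 3) ^ n\<^sup>2 * qbinomial (int M) (int n) p
       * qbinomial (int M + j + (int L - j - int n) div 2) (int M + j) p
       * qbinomial (int M - j + (int L + j - int n) div 2) (int M - j) p" for j :: int and n :: nat
  \<comment> \<open>One of the two numerators is then negative, hence so is its half. This bound
    makes the sums over j and n finite.\<close>
  have t0: "t j n = 0" if "int L < \<bar>j\<bar> + int n" for j n
  proof -
    from that have "(int L - j - int n) div 2 < 0 \<or> (int L + j - int n) div 2 < 0"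
      by auto
    then show ?thesis
      using qbinomial_neg[of "(int L - j - int n) div 2" "int M + j" p]
        qbinomial_neg[of "(int L + j - int n) div 2" "int M - j" p]
      by (auto simp: t_def)
  qed
  have halves: "\<exists>u v. int L - j - int n = 2 * int u \<and> int L + j - int n = 2 * int v"
    if jn: "\<bar>j\<bar> + int n \<le> int L" "[int L - j = int n] (mod 2)" for j n
  proof -
    obtain k where k: "int L - j - int n = 2 * k"
      using jn(2) unfolding cong_iff_dvd_diff by (rule dvdE)
    show ?thesis
      using jn(1) k by (intro exI[of _ "nat k"] exI[of _ "nat (k + j)"]) auto
  qed
  define P where "P j = {n::nat. n \<le> L \<and> [int L - j = int n] (mod 2)}" for j
  have T: "refined_qtrinomial (int L) (int M) j j (q ^ 3) = (\<Sum>n\<in>P j. t j n)" for j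
    unfolding refined_qtrinomial_def r t_def[symmetric]
    by (intro infsum_finite_support) (auto simp: P_def intro!: t0)
  let ?g = "\<lambda>j n. q powi (3 * j\<^sup>2 + 2 * j) * t j n"
  let ?w = "\<lambda>u v. q powi (3 * (int v - int u)\<^sup>2 + 2 * (int v - int u))
        * (qbin p (M + v) u * qbin p (M + u) v)"
  have "(\<Sum>\<^sub>\<infinity>j\<in>(UNIV :: int set).
            q powi (3 * j\<^sup>2 + 2 * j) * refined_qtrinomial (int L) (int M) j j (q ^ 3))
      = (\<Sum>j\<in>{- int L..int L}. q powi (3 * j\<^sup>2 + 2 * j) * refined_qtrinomial (int L) (int M) j j (q ^ 3))"
    by (intro infsum_finite_support) (auto simp: T intro!: sum.neutral t0)
  also have "\<dots> = (\<Sum>(j, n)\<in>(SIGMA j:{- int L..int L}. P j). ?g j n)"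
    unfolding T sum_distrib_left by (intro sum.Sigma) (auto simp: P_def)
  also have "\<dots> = (\<Sum>(j, n)\<in>{(j, n). \<bar>j\<bar> + int n \<le> int L \<and> [int L - j = int n] (mod 2)}. ?g j n)"
    by (intro sum.mono_neutral_right) (auto simp: P_def intro!: t0 finite_SigmaI)
  also have "\<dots> = (\<Sum>(n, u)\<in>(SIGMA n:{0..L}. {..L - n}).
      fps_nth (qbin_fps (q ^ 3) p M) n * ?w u (L - n - u))"
  \<comment> \<open>With u and v the two halves from \<open>halves\<close>, u + v = L - n and j = v
    - u = L - n - 2u.\<close>
  proof (rule sum.reindex_bij_witness[where i = "\<lambda>(n, u). (int L - int n - 2 * int u, n)"
        and j = "\<lambda>(j, n). (n, nat ((int L - j - int n) div 2))"], goal_cases)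
    case (1 a)
    obtain j n where a: "a = (j, n)" by fastforce
    with 1 obtain u v :: nat where "int L - j - int n = 2 * int u"
      using halves[of j n] by auto
    then show ?case by (simp add: a)
  next
    case (2 a)
    obtain j n where a: "a = (j, n)" by fastforce
    with 2 obtain u v :: nat where "int L - j - int n = 2 * int u" "int L + j - int n = 2 * int v"
      using halves[of j n] by auto
    then show ?case by (simp add: a)
  next
    case (3 b)
    then show ?case by auto
  next
    case (4 b)
    then show ?case by (auto simp: cong_iff_dvd_diff)
  next
    case (5 a)
    obtain j n where a: "a = (j, n)" by fastforce
    with 5 have jn: "\<bar>j\<bar> + int n \<le> int L" "[int L - j = int n] (mod 2)" by auto
    obtain u v :: nat where u: "int L - j - int n = 2 * int u" and v2: "int L + j - int n = 2 * int v"
      using halves[OF jn] by blast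
    have u_eq: "nat ((int L - j - int n) div 2) = u" and v_eq: "L - (n + u) = v"
      using u v2 by auto
    have j: "j = int v - int u" using u v2 by simp
    have du: "(int L - j - int n) div 2 = int u" and dv: "(int L + j - int n) div 2 = int v"
      using u v2 by auto
    have A: "fps_nth (qbin_fps (q ^ 3) p M) n = (q ^ 3) ^ n\<^sup>2 * qbin p M n"
      using qbin_fps_square_nth[of "q ^ 3" M n] p r by simp
    \<comment> \<open>Used with a = M and {b, c} = {u, v}, because M + j = M + v - u and M - j = M +
      u - v. If c > a + b the lower entry is negative and both sides are 0.\<close>
    have B: "qbinomial (int a + int b - int c + int c) (int a + int b - int c) p = qbin p (a + b) c"
      for a b c
    proof (cases "c \<le> a + b")
      case True
      then show ?thesis using qbinomial_nat_add[of "a + b - c" c p] by (simp add: of_nat_diff)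
    qed (simp add: qbinomial_def)
    have "t j n = fps_nth (qbin_fps (q ^ 3) p M) n * (qbin p (M + v) u * qbin p (M + u) v)"
      using B[of M v u] B[of M u v] unfolding t_def du dv A by (simp add: j qbin_def algebra_simps)
    then show ?case
      by (simp add: a u_eq v_eq) (simp add: j)
  qed
  \<comment> \<open>The inner sum is the coefficient of X^(L-n) from \<open>fps_nth_pair\<close>, so
    the outer one is a Cauchy product.\<close>
  also have "\<dots> = (\<Sum>n\<in>{0..L}. fps_nth (qbin_fps (q ^ 3) p M) n * (\<Sum>u\<le>L - n. ?w u (L - n - u)))"
    unfolding sum_distrib_left by (intro sum.Sigma[symmetric]) auto
  also have "\<dots> = fps_nth (qbin_fps (q ^ 3) p M
           * (qbin_fps q p M * qbin_fps (q ^ 5) p M * even_gf p M)) L"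
    using fps_nth_pair[OF q, of M] unfolding p_def by (subst fps_mult_nth) simp
  finally show ?thesis by (simp only: p_def)
qed

theorem theorem1p2:
  fixes L M :: nat and q :: complex
  assumes "norm q < 1"
  shows "(\<Sum>\<^sub>\<infinity>m\<in>{m::nat. [L = m] (mod 2)}.
            q ^ m\<^sup>2 * qbinomial (3 * int M) (int m) (q\<^sup>2)
            * qbinomial (2 * int M + (int L - int m) div 2) (2 * int M) (q ^ 6))
       = (\<Sum>\<^sub>\<infinity>j\<in>(UNIV :: int set).
            q powi (3 * j\<^sup>2 + 2 * j) * refined_qtrinomial (int L) (int M) j j (q ^ 3))"
  unfolding lhs_eq_fps_nth[OF assms] rhs_eq_fps_nth[OF assms] qbin_fps_triple
  by (simp only: mult.assoc)

end
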